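(* Let $n\ge 3$ and $a\ge 1$ be integers and set $\alpha=1-1/a$. For a deck of $2n$ cards starting with $n$ red cards on top of $n$ black cards, the separation distance $\mathrm{SEP}(a)$ after an $a$-shuffle satisfies $$\mathrm{SEP}(a)=1-\frac{a}{2n+1}\big(1-\alpha^{2n+1}\big)+\frac{2\theta}{3a}\,\frac{n}{n-2}\big(1-\alpha^{2n-1}\big)$$ for some real number $\theta\in[-1,1]$. In particular, for $n$ large with $a=2^{\log_2(2n)+c}$ (that is, $c$ is the real number with $a=2n\cdot 2^{c}$), $$\mathrm{SEP}(a)=1-2^{c}\big(1-e^{-2^{-c}}\big)+O\Big(\frac1a\Big),$$ with an absolute implied constant.
   Context: $a$-shuffle of $N$ cards: the deck is cut into $a$ consecutive packets of sizes $A_1,\dots,A_a\ge 0$ (packet $1$ on top, empty packets allowed), $A_1+\cdots+A_a=N$, with probability $a^{-N}\binom{N}{A_1,\dots,A_a}$; the packets are then riffled together by dropping cards one at a time from the bottoms of the packets, the next card coming from a given packet with probability proportional to its current size (equivalently, all interleavings preserving the order within each packet are equally likely). Cards of the same color are indistinguishable. If $Q_a(w)$ is the probability that the $a$-shuffle of the deck (here $N=2n$) results in the red-black pattern $w$, then $\mathrm{SEP}(a)=\max_w\big(1-\binom{2n}{n}Q_a(w)\big)$, the maximum being over all $\binom{2n}{n}$ patterns with $n$ red and $n$ black cards. *)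

theory Defs
  imports "HOL-Probability.Probability"
begin

text \<open>A deck is a list of cards whose head is the top card.\<close>

subsection \<open>Cutting the deck into packets\<close>

definition packet_sizes :: "nat \<Rightarrow> nat \<Rightarrow> nat list set" where
  "packet_sizes a N = {A. length A = a \<and> sum_list A = N}"

definition cut_prob :: "nat \<Rightarrow> nat \<Rightarrow> nat list \<Rightarrow> real" where
  "cut_prob a N A = (if A \<in> packet_sizes a N
     then fact N / prod_list (map fact A) / real a ^ N else 0)"

definition cut_pmf :: "nat \<Rightarrow> nat \<Rightarrow> nat list pmf" where
  "cut_pmf a N = embed_pmf (cut_prob a N)"

lemma finite_packet_sizes: "finite (packet_sizes a N)"
proof (rule finite_subset)
  show "packet_sizes a N \<subseteq> {A. set A \<subseteq> {..N} \<and> length A = a}"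
    by (auto simp: packet_sizes_def dest: member_le_sum_list)
qed (simp add: finite_lists_length_eq)

lemma packet_sizes_Suc:
  "packet_sizes (Suc a) N = (\<Union>k\<le>N. (#) k ` packet_sizes a (N - k))"
proof (intro equalityI subsetI)
  fix A assume "A \<in> packet_sizes (Suc a) N"
  then obtain k B where "A = k # B" "length B = a" "k + sum_list B = N"
    by (auto simp: packet_sizes_def length_Suc_conv)
  then show "A \<in> (\<Union>k\<le>N. (#) k ` packet_sizes a (N - k))"
    by (auto simp: packet_sizes_def intro!: bexI[of _ k])
qed (auto simp: packet_sizes_def)

lemma sum_inverse_fact_packet_sizes:
  "(\<Sum>A\<in>packet_sizes a N. 1 / prod_list (map fact A)) = (real a ^ N / fact N :: real)"
proof (induction a arbitrary: N)
  case 0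
  have "packet_sizes 0 N = (if N = 0 then {[]} else {})"
    by (auto simp: packet_sizes_def)
  then show ?case by (simp add: power_0_left)
next
  case (Suc a)
  have "(\<Sum>A\<in>packet_sizes (Suc a) N. 1 / prod_list (map fact A)) =
      (\<Sum>k\<le>N. \<Sum>A\<in>(#) k ` packet_sizes a (N - k). 1 / prod_list (map fact A) :: real)"
    unfolding packet_sizes_Suc
    by (rule sum.UNION_disjoint) (auto simp: finite_packet_sizes)
  also have "\<dots> = (\<Sum>k\<le>N. 1 / fact k * (\<Sum>A\<in>packet_sizes a (N - k). 1 / prod_list (map fact A)))"
    by (intro sum.cong refl, subst sum.reindex) (auto simp: sum_distrib_left)
  also have "\<dots> = (\<Sum>k\<le>N. real (N choose k) * real a ^ (N - k)) / fact N"
    unfolding Suc sum_divide_distrib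
    by (intro sum.cong refl) (simp add: binomial_fact field_simps)
  also have "(\<Sum>k\<le>N. real (N choose k) * real a ^ (N - k)) = (1 + real a) ^ N"
    by (subst binomial_ring) simp
  finally show ?case by (simp add: add.commute)
qed

lemma cut_prob_nonneg: "cut_prob a N A \<ge> 0"
proof -
  have "prod_list (map fact A) \<ge> (0::real)" for A :: "nat list"
    by (induction A) auto
  then show ?thesis by (simp add: cut_prob_def)
qed

text \<open>The multinomial weights form a probability distribution, so the definition of
  \<open>cut_pmf\<close> by \<open>embed_pmf\<close> is meaningful for \<open>a \<ge> 1\<close>.\<close>

lemma pmf_cut_pmf:
  assumes "a \<ge> 1"
  shows "pmf (cut_pmf a N) A = cut_prob a N A"
  unfolding cut_pmf_def
proof (rule pmf_embed_pmf)
  have "(\<integral>\<^sup>+A. ennreal (cut_prob a N A) \<partial>count_space UNIV) =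
      (\<Sum>A\<in>packet_sizes a N. ennreal (cut_prob a N A))"
    by (rule nn_integral_count_space'[OF finite_packet_sizes]) (auto simp: cut_prob_def)
  also have "\<dots> = ennreal (\<Sum>A\<in>packet_sizes a N. cut_prob a N A)"
    by (rule sum_ennreal) (rule cut_prob_nonneg)
  also have "(\<Sum>A\<in>packet_sizes a N. cut_prob a N A) =
      fact N / real a ^ N * (\<Sum>A\<in>packet_sizes a N. 1 / prod_list (map fact A))"
    unfolding sum_distrib_left by (intro sum.cong refl) (simp add: cut_prob_def field_simps)
  also have "\<dots> = 1"
    using assms by (simp add: sum_inverse_fact_packet_sizes)
  finally show "(\<integral>\<^sup>+A. ennreal (cut_prob a N A) \<partial>count_space UNIV) = 1" by simp
qed (rule cut_prob_nonneg)

primrec cut_deck :: "nat list \<Rightarrow> 'c list \<Rightarrow> 'c list list" where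
  "cut_deck [] xs = []"
| "cut_deck (k # ks) xs = take k xs # cut_deck ks (drop k xs)"

subsection \<open>Riffling the packets together\<close>

text \<open>A uniformly chosen card among all remaining ones lies in a given packet with probability
  proportional to the current size of that packet.\<close>

definition packet_pmf :: "'c list list \<Rightarrow> nat pmf" where
  "packet_pmf ps =
     map_pmf fst (pmf_of_set (SIGMA i:{..<length ps}. {..<length (ps ! i)}))"

lemma pmf_packet_pmf:
  assumes "concat ps \<noteq> []" and "i < length ps"
  shows "pmf (packet_pmf ps) i = real (length (ps ! i)) / real (\<Sum>j<length ps. length (ps ! j))"
proof -
  let ?S = "SIGMA i:{..<length ps}. {..<length (ps ! i)}"
  have fin: "finite ?S" by auto
  obtain p where "p \<in> set ps" "p \<noteq> []" using assms(1) by auto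
  then obtain j where "j < length ps" "ps ! j \<noteq> []" by (metis in_set_conv_nth)
  then have "(j, 0) \<in> ?S" by auto
  then have ne: "?S \<noteq> {}" by blast
  have "?S \<inter> fst -` {i} = {i} \<times> {..<length (ps ! i)}"
    using assms(2) by auto
  then have "card (?S \<inter> fst -` {i}) = length (ps ! i)"
    by (simp add: card_cartesian_product)
  moreover have "card ?S = (\<Sum>j<length ps. length (ps ! j))"
    by (subst card_SigmaI) auto
  ultimately show ?thesis
    unfolding packet_pmf_def pmf_map by (simp add: measure_pmf_of_set[OF ne fin])
qed

text \<open>\<open>riffle k ps pile\<close> drops \<open>k\<close> further cards: each one is the bottom card of the selected
  packet and lands on top of the pile dropped so far.\<close>

primrec riffle :: "nat \<Rightarrow> 'c list list \<Rightarrow> 'c list \<Rightarrow> 'c list pmf" where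
  "riffle 0 ps pile = return_pmf pile"
| "riffle (Suc k) ps pile =
     bind_pmf (packet_pmf ps)
       (\<lambda>i. riffle k (ps[i := butlast (ps ! i)]) (last (ps ! i) # pile))"

definition shuffle :: "nat \<Rightarrow> 'c list \<Rightarrow> 'c list pmf" where
  "shuffle a xs =
     bind_pmf (cut_pmf a (length xs)) (\<lambda>A. riffle (length xs) (cut_deck A xs) [])"

subsection \<open>Red-black decks and separation distance\<close>

datatype color = Red | Black

definition red_on_black :: "nat \<Rightarrow> color list" where
  "red_on_black n = replicate n Red @ replicate n Black"

definition patterns :: "nat \<Rightarrow> color list set" where
  "patterns n = {w. count_list w Red = n \<and> count_list w Black = n}"

definition pattern_prob :: "nat \<Rightarrow> nat \<Rightarrow> color list \<Rightarrow> real" where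
  "pattern_prob n a w = pmf (shuffle a (red_on_black n)) w"

definition SEP :: "nat \<Rightarrow> nat \<Rightarrow> real" where
  "SEP n a = Max ((\<lambda>w. 1 - real ((2 * n) choose n) * pattern_prob n a w) ` patterns n)"

lemma length_color_list: "length w = count_list w Red + count_list w Black"
proof (induction w)
  case (Cons x w)
  then show ?case by (cases x) auto
qed simp

text \<open>The maximum in \<open>SEP\<close> is over a finite nonempty set.\<close>

lemma finite_patterns: "finite (patterns n)"
proof (rule finite_subset)
  have "UNIV = {Red, Black}" using color.exhaust by blast
  then have "finite (UNIV :: color set)" by (metis finite.emptyI finite.insertI)
  then show "finite {w. set w \<subseteq> (UNIV :: color set) \<and> length w = 2 * n}"
    by (rule finite_lists_length_eq)
qed (auto simp: patterns_def length_color_list)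

lemma red_on_black_in_patterns: "red_on_black n \<in> patterns n"
proof -
  have "count_list (replicate n x) y = (if x = y then n else 0)" for x y :: color
    by (induction n) auto
  then show ?thesis by (simp add: patterns_def red_on_black_def)
qed

end

theory Submission
  imports Defs
begin

text \<open>An \<open>a\<close>-shuffle can be read backwards: give every card of the final deck an independent uniform
label in \<open>{..<a}\<close> (the packet it came from) and sort the deck stably by label. So the probability
that the deck \<open>xs\<close> becomes \<open>w\<close> is the proportion of labellings of the positions of \<open>w\<close> for which
stable sorting gives back \<open>xs\<close> (\<open>pmf_shuffle\<close>).

For the red-on-black deck this makes the worst pattern visible. If every red label of \<open>w\<close> is
smaller than every black label, sorting \<open>w\<close> always gives red on black, and the number of these
separating labellings is the same for all patterns. When all black cards lie above all red ones,
no other labelling works, because a tie between a red and a black label would leave the black card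
on top. Hence the maximum defining the separation distance is attained at black on red. Summing
over the largest red label \<open>k\<close>, with labels counted from 1, gives (\<open>SEP_eq\<close>)
\<open>1 - SEP n a = (2 * n choose n) / a ^ (2 * n) * (\<Sum>k. (k ^ n - (k - 1) ^ n) * (a - k) ^ n)\<close>.

Since \<open>k ^ n - (k - 1) ^ n\<close> is the integral of \<open>n * (k - t) ^ (n - 1)\<close> over \<open>t \<in> [0, 1]\<close>, the sum over
\<open>k\<close> is, for fixed \<open>t\<close>, a Riemann sum of mesh 1 for \<open>g s = n * (s - t) ^ (n - 1) * (a - s) ^ n\<close> on
\<open>[t, a]\<close>. The integral of \<open>g\<close> is a beta integral proportional to \<open>(a - t) ^ (2 * n)\<close>, and averaging
it over \<open>t\<close> produces the main term. As \<open>g\<close> and \<open>g'\<close> vanish at both ends, the second-order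
Euler-Maclaurin formula bounds the error by a twelfth of the integral of \<open>\<bar>g''\<bar>\<close>. With \<open>u = s - t\<close> and
\<open>v = a - s\<close>,
\<open>g'' = n * (n - 1) * u ^ (n - 3) * v ^ (n - 2) * (n * (u - v)\<^sup>2 - 2 * v\<^sup>2)\<close>
is a difference of two nonnegative functions with equal integrals, because \<open>g''\<close> integrates to 0;
so the integral of \<open>\<bar>g''\<bar>\<close> is at most twice the integral of the subtracted one, again a beta integral.
This gives exactly the constant of the error term.

For the limit profile, \<open>a / m * (1 - \<alpha> ^ m)\<close> is the average of \<open>\<alpha> ^ i\<close> over \<open>i < m\<close>. Passing from
\<open>m = 2 * n + 1\<close> to \<open>m = 2 * n\<close> and replacing \<open>\<alpha>\<close> by \<open>exp (- 1 / a)\<close> each cost at most \<open>1 / a\<close>.\<close>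


section \<open>The inverse description of the shuffle\<close>

text \<open>Labels are packet numbers read off a finished deck \<open>w\<close>: the cards of \<open>w\<close> with label \<open>i\<close>, in
their order in \<open>w\<close>, form the \<open>i\<close>-th packet before riffling.\<close>

definition pile :: "nat list \<Rightarrow> 'c list \<Rightarrow> nat \<Rightarrow> 'c list" where
  "pile f w i = map snd (filter (\<lambda>p. fst p = i) (zip f w))"

definition deal :: "nat \<Rightarrow> nat list \<Rightarrow> 'c list \<Rightarrow> 'c list list" where
  "deal a f w = map (pile f w) [0..<a]"

text \<open>A riffle of the packets \<open>ps\<close> is recorded by the packet numbers of its cards, so equal cards in
different packets still give different riffles.\<close>

definition interleavings :: "'c list list \<Rightarrow> 'c list \<Rightarrow> nat list set" where
  "interleavings ps w =
     {f. length f = length w \<and> set f \<subseteq> {..<length ps} \<and> deal (length ps) f w = ps}"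

lemma length_deal [simp]: "length (deal a f w) = a"
  by (simp add: deal_def)

lemma nth_deal [simp]: "i < a \<Longrightarrow> deal a f w ! i = pile f w i"
  by (simp add: deal_def)

lemma pile_append:
  "length f = length w \<Longrightarrow> pile (f @ f') (w @ w') i = pile f w i @ pile f' w' i"
  by (simp add: pile_def)

lemma pile_singleton: "pile [i] [x] j = (if i = j then [x] else [])"
  by (simp add: pile_def)

lemma deal_snoc:
  assumes "length f = length w"
  shows "deal a (f @ [i]) (w @ [x]) = (deal a f w)[i := pile f w i @ [x]]"
  by (rule nth_equalityI) (auto simp: pile_append assms pile_singleton nth_list_update)

lemma finite_interleavings: "finite (interleavings ps w)"
  by (rule finite_subset[OF _ finite_lists_length_eq[of "{..<length ps}" "length w"]])
     (auto simp: interleavings_def)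

text \<open>The bottom card of the riffled deck is the first one dropped, that is, the bottom card of
some packet. This is the recursion that \<open>riffle\<close> follows.\<close>

lemma interleavings_snoc:
  "interleavings ps (u @ [x]) =
     (\<Union>i\<in>{i. i < length ps \<and> ps ! i \<noteq> [] \<and> last (ps ! i) = x}.
        (\<lambda>f. f @ [i]) ` interleavings (ps[i := butlast (ps ! i)]) u)" (is "?L = ?R")
proof (intro equalityI subsetI)
  fix g assume "g \<in> ?L"
  then have g: "length g = Suc (length u)" "set g \<subseteq> {..<length ps}"
    "deal (length ps) g (u @ [x]) = ps"
    by (auto simp: interleavings_def)
  obtain f i where fi: "g = f @ [i]" using g(1) by (cases g rule: rev_cases) auto
  have len: "length f = length u" and i: "i < length ps" using g fi by auto
  have ps: "ps = (deal (length ps) f u)[i := pile f u i @ [x]]"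
    using g(3) deal_snoc[OF len] fi by metis
  have psi: "ps ! i = pile f u i @ [x]"
    by (subst ps) (simp add: i)
  have "ps[i := butlast (ps ! i)] = (deal (length ps) f u)[i := pile f u i]"
    unfolding psi by (subst ps) simp
  also have "\<dots> = deal (length ps) f u"
    using i list_update_id[of "deal (length ps) f u" i] by simp
  finally have "f \<in> interleavings (ps[i := butlast (ps ! i)]) u"
    using g fi len by (auto simp: interleavings_def)
  then show "g \<in> ?R" using fi i psi by auto
next
  fix g assume "g \<in> ?R"
  then obtain i f where i: "i < length ps" "ps ! i \<noteq> []" "last (ps ! i) = x"
    and g: "g = f @ [i]" and f: "f \<in> interleavings (ps[i := butlast (ps ! i)]) u"
    by auto
  from f have f': "length f = length u" "set f \<subseteq> {..<length ps}"
    and d: "deal (length ps) f u = ps[i := butlast (ps ! i)]"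
    by (auto simp: interleavings_def)
  have "pile f u i = butlast (ps ! i)"
    using arg_cong[OF d, of "\<lambda>l. l ! i"] i by simp
  then have "pile f u i @ [x] = ps ! i" using i by auto
  then have "deal (length ps) g (u @ [x]) = ps"
    using i d by (simp add: g deal_snoc[OF f'(1)])
  then show "g \<in> ?L" using f' i g by (auto simp: interleavings_def)
qed

lemma card_interleavings_snoc:
  "card (interleavings ps (u @ [x])) =
     (\<Sum>i\<in>{i. i < length ps \<and> ps ! i \<noteq> [] \<and> last (ps ! i) = x}.
        card (interleavings (ps[i := butlast (ps ! i)]) u))"
  unfolding interleavings_snoc
  by (subst card_UN_disjoint)
     (auto simp: finite_interleavings inj_on_def intro!: sum.cong card_image)

lemma set_pmf_riffle:
  "v \<in> set_pmf (riffle k ps below) \<Longrightarrow> \<exists>u. length u = k \<and> v = u @ below"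
proof (induction k arbitrary: ps below)
  case (Suc k)
  then obtain i where "v \<in> set_pmf (riffle k (ps[i := butlast (ps ! i)]) (last (ps ! i) # below))"
    by auto
  from Suc.IH[OF this] obtain u where "length u = k" "v = u @ last (ps ! i) # below" by blast
  then show ?case by (intro exI[of _ "u @ [last (ps ! i)]"]) simp
qed simp

lemma set_packet_pmf:
  assumes "concat ps \<noteq> []"
  shows "set_pmf (packet_pmf ps) \<subseteq> {..<length ps}"
proof -
  obtain p where "p \<in> set ps" "p \<noteq> []" using assms by auto
  then obtain j where "j < length ps" "ps ! j \<noteq> []" by (metis in_set_conv_nth)
  then have "(j, 0) \<in> (SIGMA i:{..<length ps}. {..<length (ps ! i)})" by auto
  then have ne: "(SIGMA i:{..<length ps}. {..<length (ps ! i)}) \<noteq> {}" by blast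
  show ?thesis unfolding packet_pmf_def by (auto simp: set_pmf_of_set[OF ne])
qed

lemma prod_fact_length_update:
  assumes "i < length ps" "ps ! i \<noteq> []"
  shows "(\<Prod>p\<leftarrow>ps. fact (length p) :: real) =
    real (length (ps ! i)) * (\<Prod>p\<leftarrow>ps[i := butlast (ps ! i)]. fact (length p))"
  using assms
proof (induction ps arbitrary: i)
  case (Cons p ps)
  show ?case
  proof (cases i)
    case 0
    then have "length p = Suc (length p - 1)" using Cons.prems by (cases p) auto
    then have "(fact (length p) :: real) = real (length p) * fact (length p - 1)"
      by (metis fact_Suc)
    then show ?thesis using 0 by simp
  next
    case (Suc j)
    then show ?thesis using Cons by simp
  qed
qed simp

text \<open>All interleavings are equally likely: each drop contributes the current size of the chosen
packet divided by the number of remaining cards, and along any interleaving these numerators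
multiply to the product of the factorials of the packet sizes.\<close>

lemma pmf_riffle:
  assumes "(\<Sum>p\<leftarrow>ps. length p) = k" "length u = k"
  shows "pmf (riffle k ps below) (u @ below) =
    real (card (interleavings ps u)) * (\<Prod>p\<leftarrow>ps. fact (length p)) / fact k"
  using assms
proof (induction k arbitrary: ps below u)
  case 0
  then have "\<forall>p\<in>set ps. p = []" by simp
  then have ps: "ps = replicate (length ps) []" by (simp add: replicate_length_same)
  have "deal (length ps) [] ([] :: 'a list) = replicate (length ps) []"
    by (rule nth_equalityI) (auto simp: pile_def)
  then have "interleavings ps [] = {[]}"
    using ps by (auto simp: interleavings_def)
  moreover have "(\<Prod>p\<leftarrow>ps. fact (length p) :: real) = 1"
    by (subst ps) simp
  ultimately show ?case using 0 by simp
next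
  case (Suc k)
  obtain u' x where u: "u = u' @ [x]" "length u' = k"
    using Suc.prems(2) by (cases u rule: rev_cases) auto
  let ?I = "{i. i < length ps \<and> ps ! i \<noteq> [] \<and> last (ps ! i) = x}"
  let ?ps = "\<lambda>i. ps[i := butlast (ps ! i)]"
  have ne: "concat ps \<noteq> []"
  proof
    assume "concat ps = []"
    then have "(\<Sum>p\<leftarrow>ps. length p) = 0" by auto
    with Suc.prems show False by simp
  qed
  have tot: "(\<Sum>j<length ps. length (ps ! j)) = Suc k"
    using Suc.prems(1) by (simp add: sum_list_sum_nth atLeast0LessThan)
  have "pmf (riffle (Suc k) ps below) (u @ below) =
      (\<Sum>i<length ps. pmf (riffle k (?ps i) (last (ps ! i) # below)) (u @ below) * pmf (packet_pmf ps) i)"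
    unfolding riffle.simps pmf_bind
    by (rule integral_measure_pmf_real) (use set_packet_pmf[OF ne] in auto)
  also have "\<dots> = (\<Sum>i\<in>?I. pmf (riffle k (?ps i) (last (ps ! i) # below)) (u @ below) * pmf (packet_pmf ps) i)"
  proof (rule sum.mono_neutral_right; (intro ballI)?)
    fix i assume i: "i \<in> {..<length ps} - ?I"
    show "pmf (riffle k (?ps i) (last (ps ! i) # below)) (u @ below) * pmf (packet_pmf ps) i = 0"
    proof (cases "ps ! i = []")
      case True
      then show ?thesis using i pmf_packet_pmf[OF ne, of i] by simp
    next
      case False
      then have "last (ps ! i) \<noteq> x" using i by auto
      then have "u @ below \<notin> set_pmf (riffle k (?ps i) (last (ps ! i) # below))"
        using set_pmf_riffle[of "u @ below" k "?ps i" "last (ps ! i) # below"] u by auto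
      then show ?thesis by (simp add: set_pmf_iff)
    qed
  qed auto
  also have "\<dots> = (\<Sum>i\<in>?I. real (card (interleavings (?ps i) u')) *
      ((\<Prod>p\<leftarrow>ps. fact (length p)) / fact (Suc k)))"
  proof (rule sum.cong[OF refl])
    fix i assume "i \<in> ?I"
    then have i: "i < length ps" "ps ! i \<noteq> []" "last (ps ! i) = x" by auto
    have "(\<Sum>p\<leftarrow>?ps i. length p) = k"
    proof -
      have "length (ps ! i) \<ge> 1" using i(2) by (cases "ps ! i") auto
      moreover have "length (ps ! i) \<le> Suc k"
        using i(1) tot member_le_sum[of i "{..<length ps}" "\<lambda>j. length (ps ! j)"] by simp
      ultimately show ?thesis
        using Suc.prems(1) i(1) by (simp add: map_update sum_list_update)
    qed
    from Suc.IH[OF this u(2), of "x # below"]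
    have "pmf (riffle k (?ps i) (last (ps ! i) # below)) (u @ below) =
      real (card (interleavings (?ps i) u')) * (\<Prod>p\<leftarrow>?ps i. fact (length p)) / fact k"
      using u i by simp
    moreover have "pmf (packet_pmf ps) i = real (length (ps ! i)) / real (Suc k)"
      using pmf_packet_pmf[OF ne i(1)] tot by simp
    ultimately show "pmf (riffle k (?ps i) (last (ps ! i) # below)) (u @ below) * pmf (packet_pmf ps) i =
      real (card (interleavings (?ps i) u')) * ((\<Prod>p\<leftarrow>ps. fact (length p)) / fact (Suc k))"
      unfolding prod_fact_length_update[OF i(1,2)] by (simp add: mult_ac del: of_nat_Suc)
  qed
  also have "\<dots> = real (card (interleavings ps u)) * (\<Prod>p\<leftarrow>ps. fact (length p)) / fact (Suc k)"
    unfolding u(1) card_interleavings_snoc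
    by (simp add: sum_distrib_right sum_divide_distrib)
  finally show ?case .
qed

lemma map_length_cut_deck: "sum_list A = length xs \<Longrightarrow> map length (cut_deck A xs) = A"
  by (induction A arbitrary: xs) auto

lemma concat_cut_deck: "sum_list A = length xs \<Longrightarrow> concat (cut_deck A xs) = xs"
  by (induction A arbitrary: xs) auto

lemma cut_deck_concat: "cut_deck (map length ps) (concat ps) = ps"
  by (induction ps) auto

text \<open>Dealing by label and stacking the piles in order is stable sorting by label.\<close>

definition labellings :: "nat \<Rightarrow> 'c list \<Rightarrow> 'c list \<Rightarrow> nat list set" where
  "labellings a xs w =
     {f. length f = length w \<and> set f \<subseteq> {..<a} \<and> concat (deal a f w) = xs}"

lemma finite_labellings: "finite (labellings a xs w)"
  by (rule finite_subset[OF _ finite_lists_length_eq[of "{..<a}" "length w"]])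
     (auto simp: labellings_def)

text \<open>The cut is determined by the labelling, as the list of its label counts.\<close>

lemma labellings_eq_Union:
  assumes "length w = length xs"
  shows "labellings a xs w = (\<Union>A\<in>packet_sizes a (length xs). interleavings (cut_deck A xs) w)"
proof (intro equalityI subsetI)
  fix f assume f: "f \<in> labellings a xs w"
  let ?A = "map length (deal a f w)"
  have c: "concat (deal a f w) = xs" using f by (simp add: labellings_def)
  have "cut_deck ?A xs = deal a f w" using cut_deck_concat[of "deal a f w"] c by simp
  moreover have "?A \<in> packet_sizes a (length xs)"
    unfolding packet_sizes_def using arg_cong[OF c, of length] by (simp add: length_concat)
  ultimately show "f \<in> (\<Union>A\<in>packet_sizes a (length xs). interleavings (cut_deck A xs) w)"
    using f by (intro UN_I[of ?A]) (auto simp: interleavings_def labellings_def)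
next
  fix f assume "f \<in> (\<Union>A\<in>packet_sizes a (length xs). interleavings (cut_deck A xs) w)"
  then obtain A where A: "length A = a" "sum_list A = length xs"
    and f: "f \<in> interleavings (cut_deck A xs) w"
    by (auto simp: packet_sizes_def)
  have "length (cut_deck A xs) = a"
    using map_length_cut_deck[OF A(2)] A(1) by (metis length_map)
  then show "f \<in> labellings a xs w"
    using f concat_cut_deck[OF A(2)] by (auto simp: interleavings_def labellings_def)
qed

text \<open>The multinomial weight of a cut and the probability of one interleaving of its packets
multiply to \<open>1 / a ^ N\<close>, so all labellings have the same weight.\<close>

lemma pmf_shuffle:
  assumes "a \<ge> 1" "length w = length xs"
  shows "pmf (shuffle a xs) w = real (card (labellings a xs w)) / real a ^ length xs"
proof -
  let ?N = "length xs"
  have "pmf (shuffle a xs) w = (\<Sum>A\<in>packet_sizes a ?N.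
      pmf (riffle ?N (cut_deck A xs) []) w * pmf (cut_pmf a ?N) A)"
    unfolding shuffle_def pmf_bind
  proof (rule integral_measure_pmf_real[OF finite_packet_sizes])
    fix A assume "A \<in> set_pmf (cut_pmf a ?N)"
    then show "A \<in> packet_sizes a ?N"
      by (auto simp: set_pmf_iff pmf_cut_pmf[OF assms(1)] cut_prob_def split: if_splits)
  qed
  also have "\<dots> = (\<Sum>A\<in>packet_sizes a ?N. real (card (interleavings (cut_deck A xs) w)) / real a ^ ?N)"
  proof (rule sum.cong[OF refl])
    fix A assume A: "A \<in> packet_sizes a ?N"
    then have ml: "map length (cut_deck A xs) = A"
      by (intro map_length_cut_deck) (simp add: packet_sizes_def)
    have pr: "(\<Prod>p\<leftarrow>cut_deck A xs. fact (length p) :: real) = prod_list (map fact A)"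
      using arg_cong[OF ml, of "map (fact :: nat \<Rightarrow> real)"] by (simp add: comp_def)
    have "prod_list (map fact A) \<noteq> (0::real)"
      by (induction A) auto
    moreover have "(\<Sum>p\<leftarrow>cut_deck A xs. length p) = ?N"
      using A by (simp add: ml packet_sizes_def)
    from pmf_riffle[OF this assms(2), of "[]"]
    have "pmf (riffle ?N (cut_deck A xs) []) w =
       real (card (interleavings (cut_deck A xs) w)) * prod_list (map fact A) / fact ?N"
      by (simp add: pr)
    ultimately show "pmf (riffle ?N (cut_deck A xs) []) w * pmf (cut_pmf a ?N) A =
      real (card (interleavings (cut_deck A xs) w)) / real a ^ ?N"
      using A by (simp add: pmf_cut_pmf[OF assms(1)] cut_prob_def)
  qed
  also have "\<dots> = real (\<Sum>A\<in>packet_sizes a ?N. card (interleavings (cut_deck A xs) w)) / real a ^ ?N"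
    by (simp add: sum_divide_distrib)
  also have "(\<Sum>A\<in>packet_sizes a ?N. card (interleavings (cut_deck A xs) w)) = card (labellings a xs w)"
    unfolding labellings_eq_Union[OF assms(2)]
  proof (rule card_UN_disjoint[symmetric]; (intro ballI impI)?)
    fix A B assume AB: "A \<in> packet_sizes a ?N" "B \<in> packet_sizes a ?N" "A \<noteq> B"
    have "map length (cut_deck A xs) = A" "map length (cut_deck B xs) = B"
      using AB by (simp_all add: packet_sizes_def map_length_cut_deck)
    then have "cut_deck A xs \<noteq> cut_deck B xs" using AB(3) by metis
    moreover have "length (cut_deck A xs) = length (cut_deck B xs)"
      using AB \<open>map length (cut_deck A xs) = A\<close> \<open>map length (cut_deck B xs) = B\<close>
      by (metis (mono_tags, lifting) length_map mem_Collect_eq packet_sizes_def)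
    ultimately show "interleavings (cut_deck A xs) w \<inter> interleavings (cut_deck B xs) w = {}"
      by (auto simp: interleavings_def)
  qed (auto simp: finite_packet_sizes finite_interleavings)
  finally show ?thesis .
qed

section \<open>The least likely red-black pattern\<close>

lemma mset_concat_update:
  "i < length ps \<Longrightarrow> mset (concat (ps[i := ps ! i @ [x]])) = add_mset x (mset (concat ps))"
proof (induction ps arbitrary: i)
  case (Cons p ps)
  show ?case
  proof (cases i)
    case (Suc j)
    then show ?thesis using Cons.IH[of j] Cons.prems by simp
  qed simp
qed simp

lemma mset_concat_deal:
  "length f = length w \<Longrightarrow> set f \<subseteq> {..<a} \<Longrightarrow> mset (concat (deal a f w)) = mset w"
proof (induction w arbitrary: f rule: rev_induct)
  case Nil
  show ?case by (simp add: deal_def pile_def)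
next
  case (snoc x w)
  obtain g i where g: "f = g @ [i]" "length g = length w" "set g \<subseteq> {..<a}" "i < a"
    using snoc.prems by (cases f rule: rev_cases) auto
  have "deal a f (w @ [x]) = (deal a g w)[i := deal a g w ! i @ [x]]"
    using g by (simp add: deal_snoc)
  then show ?case
    using snoc.IH[OF g(2,3)] mset_concat_update[of i "deal a g w" x] g(4) by simp
qed

lemma card_list_all2:
  assumes "\<And>x. finite (T x)"
  shows "finite {f. list_all2 (\<lambda>l x. l \<in> T x) f w}"
    and "card {f. list_all2 (\<lambda>l x. l \<in> T x) f w} = (\<Prod>x\<leftarrow>w. card (T x))"
proof (induction w)
  case (Cons x w)
  have eq: "{f. list_all2 (\<lambda>l x. l \<in> T x) f (x # w)} =
     (\<lambda>(l, f). l # f) ` (T x \<times> {f. list_all2 (\<lambda>l x. l \<in> T x) f w})"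
    by (auto simp: list_all2_Cons2 image_iff)
  show "finite {f. list_all2 (\<lambda>l x. l \<in> T x) f (x # w)}"
    unfolding eq using assms Cons by auto
  show "card {f. list_all2 (\<lambda>l x. l \<in> T x) f (x # w)} = (\<Prod>x\<leftarrow>x # w. card (T x))"
    unfolding eq using Cons
    by (subst card_image) (auto simp: inj_on_def card_cartesian_product)
qed auto

lemma prod_list_color:
  "(\<Prod>x\<leftarrow>w. F x) = F Red ^ count_list w Red * (F Black ^ count_list w Black :: nat)"
proof (induction w)
  case (Cons x w)
  then show ?case by (cases x) auto
qed simp

text \<open>The labellings with a threshold between the red and the black labels.\<close>

definition separating :: "nat \<Rightarrow> color list \<Rightarrow> nat list set" where
  "separating a w =
     {f. \<exists>k. list_all2 (\<lambda>l x. l \<in> (if x = Red then {..k} else {k<..<a})) f w}"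

text \<open>The red labels that are at most \<open>k\<close> but not all smaller than \<open>k\<close> and the black labels above \<open>k\<close>
are chosen independently, whatever the order of the colours in \<open>w\<close>.\<close>

lemma card_separating:
  assumes w: "w \<in> patterns n" and n: "n \<ge> 1"
  shows "real (card (separating a w)) =
    (\<Sum>k<a. (real (k + 1) ^ n - real k ^ n) * real (a - 1 - k) ^ n)"
proof -
  define X where "X k = {f. list_all2 (\<lambda>l x. l \<in> (if x = Red then {..k} else {k<..<a})) f w}" for k
  define Y where "Y k = {f. list_all2 (\<lambda>l x. l \<in> (if x = Red then {..<k} else {k<..<a})) f w}" for k
  have cnt: "count_list w Red = n" "count_list w Black = n"
    using w by (auto simp: patterns_def)
  have finX: "finite (X k)" and cX: "card (X k) = (k + 1) ^ n * (a - 1 - k) ^ n"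
    and finY: "finite (Y k)" and cY: "card (Y k) = k ^ n * (a - 1 - k) ^ n" for k
    using card_list_all2[of "\<lambda>x. if x = Red then {..k} else {k<..<a}" w]
      card_list_all2[of "\<lambda>x. if x = Red then {..<k} else {k<..<a}" w]
    by (auto simp: X_def Y_def prod_list_color cnt)
  have YX: "Y k \<subseteq> X k" for k
    unfolding X_def Y_def by (auto elim!: list_all2_mono split: if_splits)
  have black: "\<exists>i<length w. w ! i = Black" and red: "\<exists>i<length w. w ! i = Red"
    using cnt n by (metis count_list_0_iff in_set_conv_nth not_one_le_zero)+
  \<comment> \<open>A member of \<open>X k - Y k\<close> is a separating labelling whose largest red label is \<open>k\<close>.\<close>
  have "separating a w = (\<Union>k<a. X k - Y k)"
  proof (intro equalityI subsetI)
    fix f assume "f \<in> separating a w"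
    then obtain k where "f \<in> X k" by (auto simp: separating_def X_def)
    define m where "m = (LEAST k. f \<in> X k)"
    have m: "f \<in> X m" unfolding m_def by (rule LeastI) fact
    have "f \<notin> Y m"
    proof
      assume Y: "f \<in> Y m"
      have "m > 0" using Y red by (auto simp: Y_def list_all2_conv_all_nth)
      then have "f \<in> X (m - 1)"
        using Y unfolding X_def Y_def by (auto elim!: list_all2_mono split: if_splits)
      then have "m \<le> m - 1" unfolding m_def by (rule Least_le)
      with \<open>m > 0\<close> show False by simp
    qed
    moreover have "m < a" using m black by (fastforce simp: X_def list_all2_conv_all_nth)
    ultimately show "f \<in> (\<Union>k<a. X k - Y k)" using m by auto
  next
    fix f assume "f \<in> (\<Union>k<a. X k - Y k)"
    then show "f \<in> separating a w" unfolding separating_def X_def by blast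
  qed
  moreover have "(X i - Y i) \<inter> (X j - Y j) = {}" if "i < j" for i j
  proof -
    have "X i \<inter> X j \<subseteq> Y j"
    proof
      fix f assume "f \<in> X i \<inter> X j"
      then have f: "list_all2 (\<lambda>l x. l \<in> (if x = Red then {..i} else {i<..<a})) f w"
        "list_all2 (\<lambda>l x. l \<in> (if x = Red then {..j} else {j<..<a})) f w"
        by (auto simp: X_def)
      show "f \<in> Y j"
        using f that unfolding Y_def mem_Collect_eq list_all2_conv_all_nth
        by (smt (verit) atMost_iff lessThan_iff order_le_less_trans)
    qed
    then show ?thesis by blast
  qed
  then have "\<forall>i\<in>{..<a}. \<forall>j\<in>{..<a}. i \<noteq> j \<longrightarrow> (X i - Y i) \<inter> (X j - Y j) = {}"
    by (metis inf_commute linorder_neqE_nat)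
  ultimately have "card (separating a w) = (\<Sum>k<a. card (X k - Y k))"
    using finX by (simp add: card_UN_disjoint)
  then have "real (card (separating a w)) = (\<Sum>k<a. real (card (X k) - card (Y k)))"
    by (simp add: card_Diff_subset finY YX)
  also have "\<dots> = (\<Sum>k<a. (real (k + 1) ^ n - real k ^ n) * real (a - 1 - k) ^ n)"
  proof (rule sum.cong[OF refl])
    fix k
    have "card (Y k) \<le> card (X k)" by (intro card_mono finX YX)
    then show "real (card (X k) - card (Y k)) = (real (k + 1) ^ n - real k ^ n) * real (a - 1 - k) ^ n"
      by (simp add: of_nat_diff cX cY algebra_simps)
  qed
  finally show ?thesis .
qed

lemma set_pile:
  "x \<in> set (pile f w i) \<longleftrightarrow> (\<exists>j. j < length f \<and> j < length w \<and> f ! j = i \<and> w ! j = x)"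
  by (force simp: pile_def in_set_zip image_iff)

text \<open>The piles up to the threshold are purely red and the later ones purely black, so stacking them
gives red on black.\<close>

lemma separating_subset_labellings:
  assumes w: "w \<in> patterns n" and n: "n \<ge> 1"
  shows "separating a w \<subseteq> labellings a (red_on_black n) w"
proof
  fix f assume "f \<in> separating a w"
  then obtain k where k: "list_all2 (\<lambda>l x. l \<in> (if x = Red then {..k} else {k<..<a})) f w"
    by (auto simp: separating_def)
  have len: "length f = length w" using k by (rule list_all2_lengthD)
  have pt: "f ! j \<in> (if w ! j = Red then {..k} else {k<..<a})" if "j < length w" for j
    using k that by (auto simp: list_all2_conv_all_nth)
  obtain j where "j < length w" "w ! j = Black"
    using w n unfolding patterns_def
    by (metis (mono_tags, lifting) count_list_0_iff in_set_conv_nth mem_Collect_eq not_one_le_zero)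
  then have ka: "k < a" using pt[of j] by auto
  have fa: "set f \<subseteq> {..<a}"
    using pt ka len by (force simp: in_set_conv_nth split: if_splits)
  have split: "[0..<a] = [0..<Suc k] @ [Suc k..<a]"
    using ka upt_add_eq_append[of 0 "Suc k" "a - Suc k"] by simp
  let ?u = "concat (map (pile f w) [0..<Suc k])" and ?v = "concat (map (pile f w) [Suc k..<a])"
  have uv: "concat (deal a f w) = ?u @ ?v"
    unfolding deal_def split by simp
  have "\<forall>x\<in>set ?u. x = Red"
    using pt by (fastforce simp: set_pile split: if_splits)
  then obtain p where u: "?u = replicate p Red" by (metis replicate_length_same)
  have "\<forall>x\<in>set ?v. x \<noteq> Red"
    using pt by (fastforce simp: set_pile split: if_splits)
  then have "\<forall>x\<in>set ?v. x = Black" using color.exhaust by blast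
  then obtain q where v: "?v = replicate q Black" by (metis replicate_length_same)
  have cl: "count_list (replicate m x) y = (if x = y then m else 0)" for m and x y :: color
    by (induction m) auto
  have cnt: "count_list (replicate p Red @ replicate q Black) x = n" for x
  proof -
    have "count_list (replicate p Red @ replicate q Black) x = count_list w x"
      using mset_concat_deal[OF len fa] unfolding uv u v by (metis count_mset)
    then show ?thesis using w by (cases x) (auto simp: patterns_def)
  qed
  have "p = n" "q = n" using cnt[of Red] cnt[of Black] by (simp_all add: cl)
  then have "concat (deal a f w) = red_on_black n"
    unfolding uv u v red_on_black_def by simp
  then show "f \<in> labellings a (red_on_black n) w"
    using len fa by (simp add: labellings_def)
qed

definition black_on_red :: "nat \<Rightarrow> color list" where
  "black_on_red n = replicate n Black @ replicate n Red"

lemma black_on_red_in_patterns: "black_on_red n \<in> patterns n"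
proof -
  have "count_list (replicate n x) y = (if x = y then n else 0)" for x y :: color
    by (induction n) auto
  then show ?thesis by (simp add: patterns_def black_on_red_def)
qed

lemma sorted_wrt_concat:
  assumes "sorted_wrt R (concat ps)" "i < j" "j < length ps" "x \<in> set (ps ! i)" "y \<in> set (ps ! j)"
  shows "R x y"
proof -
  have "concat ps = concat (take j ps) @ concat (drop j ps)"
    by (metis append_take_drop_id concat_append)
  moreover have "x \<in> set (concat (take j ps))"
    using assms by (auto simp: in_set_conv_nth[of _ "take j ps"] intro!: bexI[of _ "ps ! i"] exI[of _ i])
  moreover have "y \<in> set (concat (drop j ps))"
    using assms by (auto simp: Cons_nth_drop_Suc[symmetric])
  ultimately show ?thesis using assms(1) by (auto simp: sorted_wrt_append)
qed

lemma sorted_wrt_nth_concat: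
  assumes "sorted_wrt R (concat ps)" "i < length ps"
  shows "sorted_wrt R (ps ! i)"
  using assms id_take_nth_drop[OF assms(2)]
  by (metis concat.simps(2) concat_append sorted_wrt_append)

text \<open>Two cards out of order in the final deck can only be put in order by strictly different
labels: with equal labels the black card stays above the red one in their common pile.\<close>

lemma labellings_black_on_red_subset:
  assumes n: "n \<ge> 1"
  shows "labellings a (red_on_black n) (black_on_red n) \<subseteq> separating a (black_on_red n)"
proof
  let ?w = "black_on_red n"
  fix f assume "f \<in> labellings a (red_on_black n) ?w"
  then have f: "length f = 2 * n" "set f \<subseteq> {..<a}" "concat (deal a f ?w) = red_on_black n"
    by (auto simp: labellings_def black_on_red_def)
  let ?R = "\<lambda>x y. \<not> (x = Black \<and> y = Red)"
  have srt: "sorted_wrt ?R (concat (deal a f ?w))"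
    unfolding f(3) red_on_black_def by (auto simp: sorted_wrt_append sorted_wrt_iff_nth_less[of _ "replicate _ _"])
  have fa: "f ! i < a" if "i < 2 * n" for i
    using f(1,2) that nth_mem[of i f] by (auto simp del: nth_mem)
  have lw: "length ?w = 2 * n" by (simp add: black_on_red_def)
  have less: "f ! j < f ! i" if ij: "i < n" "n \<le> j" "j < 2 * n" for i j
  proof (rule ccontr)
    assume "\<not> f ! j < f ! i"
    then consider "f ! i < f ! j" | "f ! i = f ! j" by linarith
    then show False
    proof cases
      case 1
      have "Black \<in> set (deal a f ?w ! (f ! i))" "Red \<in> set (deal a f ?w ! (f ! j))"
        using ij fa f(1) lw by (auto simp: set_pile black_on_red_def nth_append intro: exI[of _ i] exI[of _ j])
      from sorted_wrt_concat[OF srt 1 _ this] fa[of j] ij show False by simp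
    next
      case 2
      have eq: "pile f ?w (f ! i) = pile (take n f) (replicate n Black) (f ! i) @
          pile (drop n f) (replicate n Red) (f ! i)"
        using pile_append[of "take n f" "replicate n Black" "drop n f" "replicate n Red" "f ! i"] f(1)
        by (simp add: black_on_red_def)
      have "Black \<in> set (pile (take n f) (replicate n Black) (f ! i))"
        using ij f(1) by (auto simp: set_pile intro!: exI[of _ i])
      moreover have "Red \<in> set (pile (drop n f) (replicate n Red) (f ! i))"
        using ij f(1) 2 by (auto simp: set_pile intro!: exI[of _ "j - n"])
      moreover have "sorted_wrt ?R (pile f ?w (f ! i))"
        using sorted_wrt_nth_concat[OF srt, of "f ! i"] fa[of i] ij by simp
      ultimately show False unfolding eq by (auto simp: sorted_wrt_append)
    qed
  qed
  define k where "k = Max ((\<lambda>j. f ! j) ` {n..<2 * n})"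
  have ne: "{n..<2 * n} \<noteq> {}" using n by auto
  have "list_all2 (\<lambda>l x. l \<in> (if x = Red then {..k} else {k<..<a})) f ?w"
    unfolding list_all2_conv_all_nth
  proof (intro conjI allI impI)
    fix i assume "i < length f"
    then have i: "i < 2 * n" using f(1) by simp
    show "f ! i \<in> (if ?w ! i = Red then {..k} else {k<..<a})"
    proof (cases "i < n")
      case True
      then have "f ! i > k" unfolding k_def using less[OF True] ne by (subst Max_less_iff) auto
      then show ?thesis using True fa[OF i] by (simp add: black_on_red_def nth_append)
    next
      case False
      then have "f ! i \<le> k" unfolding k_def using i by (intro Max_ge) auto
      then show ?thesis using False i by (simp add: black_on_red_def nth_append)
    qed
  qed (simp add: f(1) lw)
  then show "f \<in> separating a ?w" unfolding separating_def by blast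
qed

text \<open>For \<open>n \<ge> 1\<close>, the probability that some boundary between packets of the cut falls exactly between the red
and the black cards, with \<open>k\<close> counting packets up to the last one that contains a red card.\<close>

definition separating_prob :: "nat \<Rightarrow> nat \<Rightarrow> real" where
  "separating_prob n a = real ((2 * n) choose n) / real a ^ (2 * n) *
     (\<Sum>k=1..<a. (real k ^ n - (real k - 1) ^ n) * (real a - real k) ^ n)"

lemma scaled_card_separating:
  assumes w: "w \<in> patterns n" and n: "n \<ge> 1"
  shows "real ((2 * n) choose n) * (real (card (separating a w)) / real a ^ (2 * n)) = separating_prob n a"
proof -
  have "real (card (separating a w)) =
    (\<Sum>k<a. (real (k + 1) ^ n - real k ^ n) * real (a - 1 - k) ^ n)"
    by (rule card_separating[OF assms])
  also have "\<dots> = (\<Sum>k=1..<a + 1. (real k ^ n - (real k - 1) ^ n) * (real a - real k) ^ n)"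
    by (rule sum.reindex_bij_witness[of _ "\<lambda>k. k - 1" Suc]) (auto simp: of_nat_diff)
  also have "\<dots> = (\<Sum>k=1..<a. (real k ^ n - (real k - 1) ^ n) * (real a - real k) ^ n)"
    using n by (cases "a = 0") auto
  finally show ?thesis by (simp add: separating_prob_def)
qed

lemma SEP_eq:
  assumes n: "n \<ge> 1" and a: "a \<ge> 1"
  shows "SEP n a = 1 - separating_prob n a"
  unfolding SEP_def
proof (rule Max_eqI)
  show "finite ((\<lambda>w. 1 - real ((2 * n) choose n) * pattern_prob n a w) ` patterns n)"
    by (intro finite_imageI finite_patterns)
  have prob: "pattern_prob n a w = real (card (labellings a (red_on_black n) w)) / real a ^ (2 * n)"
    if "w \<in> patterns n" for w
    using that pmf_shuffle[OF a, of w "red_on_black n"]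
    by (simp add: pattern_prob_def patterns_def length_color_list[of w] red_on_black_def mult_2)
  show "y \<le> 1 - separating_prob n a"
    if y: "y \<in> (\<lambda>w. 1 - real ((2 * n) choose n) * pattern_prob n a w) ` patterns n" for y
  proof -
    obtain w where w: "w \<in> patterns n" "y = 1 - real ((2 * n) choose n) * pattern_prob n a w"
      using y by blast
    have "card (separating a w) \<le> card (labellings a (red_on_black n) w)"
      by (intro card_mono finite_labellings separating_subset_labellings w n)
    then have "separating_prob n a \<le> real ((2 * n) choose n) * pattern_prob n a w"
      unfolding prob[OF w(1)] scaled_card_separating[OF w(1) n, of a, symmetric]
      by (intro mult_left_mono divide_right_mono) auto
    with w show ?thesis by simp
  qed
  have "labellings a (red_on_black n) (black_on_red n) = separating a (black_on_red n)"
    using labellings_black_on_red_subset[OF n]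
      separating_subset_labellings[OF black_on_red_in_patterns n] by blast
  then have "1 - real ((2 * n) choose n) * pattern_prob n a (black_on_red n) = 1 - separating_prob n a"
    by (simp add: prob[OF black_on_red_in_patterns] scaled_card_separating[OF black_on_red_in_patterns n, symmetric])
  then show "1 - separating_prob n a \<in>
      (\<lambda>w. 1 - real ((2 * n) choose n) * pattern_prob n a w) ` patterns n"
    using black_on_red_in_patterns by (metis (no_types, lifting) imageI)
qed

section \<open>Comparison of the sum with an integral\<close>

text \<open>Integrating a pointwise bound, stated through antiderivatives so that no integrals have to be
formed.\<close>

lemma abs_increment_le:
  fixes F W :: "real \<Rightarrow> real"
  assumes "x \<le> y"
    and F: "\<And>s. s \<in> {x..y} \<Longrightarrow> (F has_real_derivative f s) (at s)"
    and W: "\<And>s. s \<in> {x..y} \<Longrightarrow> (W has_real_derivative w s) (at s)"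
    and le: "\<And>s. s \<in> {x..y} \<Longrightarrow> \<bar>f s\<bar> \<le> w s"
  shows "\<bar>F y - F x\<bar> \<le> W y - W x"
proof -
  have "W x - F x \<le> W y - F y"
  proof (rule DERIV_nonneg_imp_nondecreasing[OF assms(1)])
    fix s assume "x \<le> s" "s \<le> y"
    then show "\<exists>d. ((\<lambda>s. W s - F s) has_real_derivative d) (at s) \<and> 0 \<le> d"
      using F[of s] W[of s] le[of s] by (intro exI[of _ "w s - f s"]) (auto intro: DERIV_diff)
  qed
  moreover have "W x + F x \<le> W y + F y"
  proof (rule DERIV_nonneg_imp_nondecreasing[OF assms(1)])
    fix s assume "x \<le> s" "s \<le> y"
    then show "\<exists>d. ((\<lambda>s. W s + F s) has_real_derivative d) (at s) \<and> 0 \<le> d"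
      using F[of s] W[of s] le[of s] by (intro exI[of _ "w s + f s"]) (auto intro: DERIV_add)
  qed
  ultimately show ?thesis by linarith
qed

text \<open>On each unit interval \<open>[k, k + 1]\<close> the function \<open>\<Phi> k\<close> below is an antiderivative of \<open>b * g''\<close>, where
\<open>b s = ((s - k)\<^sup>2 - (s - k) + 1/6) / 2\<close> is half the second Bernoulli polynomial, which is bounded by
\<open>1/12\<close>. It comes from integrating by parts twice. The increments telescope to the difference of sum
and integral. The starting point \<open>t\<close> need not be an integer, since \<open>g\<close> and \<open>g'\<close> vanish there and
so do their contributions to \<open>\<Phi> 0 t\<close>.\<close>

lemma euler_maclaurin:
  fixes G g g1 g2 W w :: "real \<Rightarrow> real" and a :: nat
  assumes t: "0 \<le> t" "t \<le> 1" and a: "a \<ge> 1"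
    and G: "\<And>s. (G has_real_derivative g s) (at s)"
    and g: "\<And>s. (g has_real_derivative g1 s) (at s)"
    and g1: "\<And>s. (g1 has_real_derivative g2 s) (at s)"
    and W: "\<And>s. (W has_real_derivative w s) (at s)"
    and le: "\<And>s. t \<le> s \<Longrightarrow> s \<le> real a \<Longrightarrow> \<bar>g2 s\<bar> \<le> w s"
    and ends: "g t = 0" "g1 t = 0" "g a = 0" "g1 a = 0"
  shows "\<bar>(\<Sum>k=1..<a. g (real k)) - (G a - G t)\<bar> \<le> (W a - W t) / 12"
proof -
  define \<Phi> where "\<Phi> k s = ((s - k)^2 - (s - k) + 1/6) / 2 * g1 s - (2 * (s - k) - 1) / 2 * g s + G s"
    for k s :: real
  have half_bound: "\<bar>(q + 1/6) / 2\<bar> \<le> 1/12" if "q \<le> 0" "q \<ge> - (1/4)" for q :: real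
    using that by (auto simp: abs_if)
  have step: "\<bar>\<Phi> k y - \<Phi> k x\<bar> \<le> (W y - W x) / 12"
    if "x \<le> y" "k \<le> x" "y \<le> k + 1" "t \<le> x" "y \<le> a" for k x y
  proof -
    have "\<bar>\<Phi> k y - \<Phi> k x\<bar> \<le> W y / 12 - W x / 12"
    proof (rule abs_increment_le[OF that(1)])
      fix s assume s: "s \<in> {x..y}"
      show "(\<Phi> k has_real_derivative ((s - k)^2 - (s - k) + 1/6) / 2 * g2 s) (at s)"
        unfolding \<Phi>_def
        by (rule derivative_eq_intros G g g1 refl | simp)+
      show "((\<lambda>s. W s / 12) has_real_derivative w s / 12) (at s)"
        by (rule DERIV_cdivide[OF W])
      have "(s - k) * (1 - (s - k)) \<ge> 0" "(s - k - 1/2)^2 \<ge> 0"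
        using s that by auto
      then have "(s - k)^2 - (s - k) \<le> 0" "(s - k)^2 - (s - k) \<ge> - (1/4)"
        by (simp_all add: power2_eq_square algebra_simps)
      then have "\<bar>((s - k)^2 - (s - k) + 1/6) / 2\<bar> \<le> 1/12"
        using half_bound by blast
      then have "\<bar>((s - k)^2 - (s - k) + 1/6) / 2\<bar> * \<bar>g2 s\<bar> \<le> 1/12 * w s"
        using le[of s] s that by (intro mult_mono) auto
      then show "\<bar>((s - k)^2 - (s - k) + 1/6) / 2 * g2 s\<bar> \<le> w s / 12"
        by (simp add: abs_mult)
    qed
    then show ?thesis by (simp add: diff_divide_distrib)
  qed
  have "\<bar>(\<Sum>k=1..<Suc m. g (real k)) + g (Suc m) / 2 - g1 (Suc m) / 12 - (G (Suc m) - G t)\<bar>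
      \<le> (W (Suc m) - W t) / 12" if "Suc m \<le> a" for m
    using that
  proof (induction m)
    case 0
    have "\<bar>\<Phi> 0 1 - \<Phi> 0 t\<bar> \<le> (W 1 - W t) / 12"
      using t 0 by (intro step) auto
    moreover have "\<Phi> 0 1 - \<Phi> 0 t = - (g 1 / 2 - g1 1 / 12 - (G 1 - G t))"
      using ends by (simp add: \<Phi>_def field_simps)
    ultimately show ?case by (simp del: minus_diff_eq)
  next
    case (Suc m)
    let ?k = "real (Suc m)"
    have "\<bar>\<Phi> ?k (?k + 1) - \<Phi> ?k ?k\<bar> \<le> (W (?k + 1) - W ?k) / 12"
      using t Suc.prems by (intro step) auto
    moreover have "\<Phi> ?k (?k + 1) - \<Phi> ?k ?k =
        g1 (?k + 1) / 12 - g (?k + 1) / 2 + G (?k + 1) - g1 ?k / 12 - g ?k / 2 - G ?k"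
      by (simp add: \<Phi>_def field_simps)
    moreover have "real (Suc (Suc m)) = ?k + 1" by simp
    moreover have "(\<Sum>k=1..<Suc (Suc m). g (real k)) = (\<Sum>k=1..<Suc m. g (real k)) + g ?k"
      by simp
    ultimately show ?case
      using Suc.IH Suc.prems by (simp only: abs_le_iff diff_divide_distrib) linarith
  qed
  from this[of "a - 1"] show ?thesis using a ends by simp
qed

text \<open>The beta integral of \<open>(s - t) ^ p * (b - s) ^ q\<close> over \<open>[t, b]\<close>, by parts: each step trades a
factor \<open>b - s\<close> for a factor \<open>s - t\<close>.\<close>

lemma beta_antiderivative:
  fixes t b :: real
  shows "\<exists>F. (\<forall>s. (F has_real_derivative (s - t) ^ p * (b - s) ^ q) (at s)) \<and>
    F b - F t = fact p * fact q / fact (p + q + 1) * (b - t) ^ (p + q + 1)"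
proof (induction q arbitrary: p)
  case 0
  have "((\<lambda>s. (s - t) ^ (p + 1) / real (p + 1)) has_real_derivative (s - t) ^ p * (b - s) ^ 0) (at s)" for s
  proof -
    have "((\<lambda>s. (s - t) ^ Suc p) has_real_derivative real (Suc p) * (s - t) ^ p) (at s)"
      by (rule derivative_eq_intros refl | simp)+
    from DERIV_cdivide[OF this, of "real (Suc p)"] show ?thesis by (simp del: of_nat_Suc)
  qed
  moreover have "(b - t) ^ (p + 1) / real (p + 1) - (t - t) ^ (p + 1) / real (p + 1) =
      fact p * fact 0 / fact (p + 0 + 1) * (b - t) ^ (p + 0 + 1)"
    by (simp del: of_nat_Suc)
  ultimately show ?case by blast
next
  case (Suc q)
  obtain F where F: "\<And>s. (F has_real_derivative (s - t) ^ (p + 1) * (b - s) ^ q) (at s)"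
    "F b - F t = fact (p + 1) * fact q / fact (p + 1 + q + 1) * (b - t) ^ (p + 1 + q + 1)"
    using Suc[of "p + 1"] by blast
  let ?F = "\<lambda>s. ((s - t) ^ (p + 1) * (b - s) ^ (q + 1) + real (q + 1) * F s) / real (p + 1)"
  have "(?F has_real_derivative (s - t) ^ p * (b - s) ^ Suc q) (at s)" for s
    by (rule derivative_eq_intros F refl | simp)+
  moreover have "?F b - ?F t = real (q + 1) / real (p + 1) * (F b - F t)"
    by (simp add: diff_divide_distrib[symmetric] right_diff_distrib del: of_nat_add)
  moreover have "\<dots> = fact p * fact (Suc q) / fact (p + Suc q + 1) * (b - t) ^ (p + Suc q + 1)"
  proof -
    have "p + 1 + q + 1 = p + Suc q + 1" by simp
    moreover have "(fact (p + 1) :: real) = real (p + 1) * fact p"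
      and "(fact (Suc q) :: real) = real (q + 1) * fact q"
      using fact_Suc[of p, where 'a = real] fact_Suc[of q, where 'a = real] by simp_all
    moreover have "real (p + 1) \<noteq> 0" by simp
    ultimately show ?thesis unfolding F(2) by (simp del: of_nat_add fact_Suc)
  qed
  ultimately show ?case by (intro exI[of _ ?F]) auto
qed

text \<open>With \<open>n = m + 3\<close>, the expression \<open>g2\<close> is the second derivative of \<open>n * u ^ (n - 1) * v ^ n\<close> for
\<open>u = s - t\<close> and \<open>v = a - s\<close>. It equals \<open>P - Q\<close> with \<open>P\<close> a nonnegative multiple of \<open>(u - v)\<^sup>2\<close> and
\<open>Q = 2 * n * (n - 1) * u ^ (n - 3) * v ^ n\<close>, so \<open>\<bar>g2\<bar> \<le> P + Q = g2 + 2 * Q\<close>. In this form the first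
summand integrates to 0.\<close>

lemma abs_second_derivative_bound:
  fixes m :: nat and u v :: real
  assumes "u \<ge> 0" "v \<ge> 0"
  defines "g2 \<equiv> real (m + 3) * (real (m + 2) * real (m + 1) * u ^ m * v ^ (m + 3)
       - 2 * real (m + 2) * real (m + 3) * u ^ (m + 1) * v ^ (m + 2)
       + real (m + 3) * real (m + 2) * u ^ (m + 2) * v ^ (m + 1))"
  shows "\<bar>g2\<bar> \<le> g2 + 4 * real (m + 3) * real (m + 2) * (u ^ m * v ^ (m + 3))"
proof -
  have "2 * g2 + 4 * real (m + 3) * real (m + 2) * (u ^ m * v ^ (m + 3)) =
      2 * real (m + 3) ^ 2 * real (m + 2) * u ^ m * v ^ (m + 1) * (u - v)\<^sup>2"
    unfolding g2_def by (simp add: power_add power2_eq_square power3_eq_cube algebra_simps)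
  also have "\<dots> \<ge> 0" using assms by simp
  finally have "- g2 \<le> g2 + 4 * real (m + 3) * real (m + 2) * (u ^ m * v ^ (m + 3))" by simp
  moreover have "4 * real (m + 3) * real (m + 2) * (u ^ m * v ^ (m + 3)) \<ge> 0"
    using assms by simp
  ultimately show ?thesis by linarith
qed

text \<open>The Riemann sum estimate for a fixed shift \<open>t\<close>. Both the integral of \<open>g\<close> and the majorant of
\<open>\<bar>g''\<bar>\<close> are beta integrals. Writing \<open>n = m + 3\<close> keeps the
exponent \<open>n - 3\<close> of \<open>g''\<close> a natural number.\<close>

lemma riemann_sum_error:
  fixes t :: real and a m :: nat
  assumes t: "0 \<le> t" "t \<le> 1" and a: "a \<ge> 1"
  defines "n \<equiv> m + 3"
  shows "\<bar>(\<Sum>k=1..<a. real n * (real k - t) ^ (n - 1) * (real a - real k) ^ n)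
      - (fact n)\<^sup>2 / fact (2 * n) * (real a - t) ^ (2 * n)\<bar>
    \<le> real n * real (n - 1) * fact (n - 3) * fact n / (3 * fact (2 * n - 2))
        * (real a - t) ^ (2 * n - 2)"
proof -
  define g where "g s = real n * ((s - t) ^ (m + 2) * (real a - s) ^ (m + 3))" for s
  define g1 where "g1 s = real n * (real (m + 2) * (s - t) ^ (m + 1) * (real a - s) ^ (m + 3)
      - real (m + 3) * (s - t) ^ (m + 2) * (real a - s) ^ (m + 2))" for s
  define g2 where "g2 s = real n * (real (m + 2) * real (m + 1) * (s - t) ^ m * (real a - s) ^ (m + 3)
       - 2 * real (m + 2) * real (m + 3) * (s - t) ^ (m + 1) * (real a - s) ^ (m + 2)
       + real (m + 3) * real (m + 2) * (s - t) ^ (m + 2) * (real a - s) ^ (m + 1))" for s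
  have dg: "(g has_real_derivative g1 s) (at s)" for s
    unfolding g_def g1_def
    by (rule derivative_eq_intros refl | simp)+
  have dg1: "(g1 has_real_derivative g2 s) (at s)" for s
    unfolding g1_def g2_def
    by (rule derivative_eq_intros refl | simp)+
  obtain F where F: "\<And>s. (F has_real_derivative (s - t) ^ (m + 2) * (real a - s) ^ (m + 3)) (at s)"
    "F (real a) - F t = fact (m + 2) * fact (m + 3) / fact (m + 2 + (m + 3) + 1) * (real a - t) ^ (m + 2 + (m + 3) + 1)"
    using beta_antiderivative[of t "m + 2" "real a" "m + 3"] by blast
  obtain V where V: "\<And>s. (V has_real_derivative (s - t) ^ m * (real a - s) ^ (m + 3)) (at s)"
    "V (real a) - V t = fact m * fact (m + 3) / fact (m + (m + 3) + 1) * (real a - t) ^ (m + (m + 3) + 1)"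
    using beta_antiderivative[of t m "real a" "m + 3"] by blast
  define G where "G s = real n * F s" for s
  define W where "W s = g1 s + 4 * real (m + 3) * real (m + 2) * V s" for s
  have dG: "(G has_real_derivative g s) (at s)" for s
    unfolding G_def g_def by (rule DERIV_cmult[OF F(1)])
  have dW: "(W has_real_derivative g2 s + 4 * real (m + 3) * real (m + 2) *
      ((s - t) ^ m * (real a - s) ^ (m + 3))) (at s)" for s
    unfolding W_def by (rule DERIV_add[OF dg1 DERIV_cmult[OF V(1)]])
  have ends: "g t = 0" "g1 t = 0" "g a = 0" "g1 a = 0"
    by (simp_all add: g_def g1_def)
  have "\<bar>(\<Sum>k=1..<a. g (real k)) - (G a - G t)\<bar> \<le> (W a - W t) / 12"
  proof (rule euler_maclaurin[OF t a dG dg dg1 dW _ ends])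
    fix s assume "t \<le> s" "s \<le> real a"
    then show "\<bar>g2 s\<bar> \<le> g2 s + 4 * real (m + 3) * real (m + 2) * ((s - t) ^ m * (real a - s) ^ (m + 3))"
      using abs_second_derivative_bound[of "s - t" "a - s" m] unfolding g2_def n_def by auto
  qed
  moreover have "G a - G t = (fact n)\<^sup>2 / fact (2 * n) * (real a - t) ^ (2 * n)"
  proof -
    have "G a - G t = real n * (F a - F t)" by (simp add: G_def algebra_simps)
    moreover have "m + 2 + (m + 3) + 1 = 2 * n" "m + 3 = n" by (simp_all add: n_def)
    moreover have "real n * fact (m + 2) = fact n"
      using fact_Suc[of "m + 2", where 'a = real] by (simp add: n_def numeral_3_eq_3)
    ultimately show ?thesis unfolding F(2) by (simp only: power2_eq_square times_divide_eq_left mult.assoc[symmetric] times_divide_eq_right)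
  qed
  moreover have "(W a - W t) / 12 = real n * real (n - 1) * fact (n - 3) * fact n / (3 * fact (2 * n - 2))
        * (real a - t) ^ (2 * n - 2)"
  proof -
    have "W a - W t = 4 * real (m + 3) * real (m + 2) * (V a - V t)"
      by (simp add: W_def ends algebra_simps)
    moreover have "m + (m + 3) + 1 = 2 * n - 2" "m = n - 3" "m + 3 = n" "m + 2 = n - 1"
      by (simp_all add: n_def)
    ultimately show ?thesis unfolding V(2) by (simp del: of_nat_diff One_nat_def fact_Suc)
  qed
  moreover have "(\<Sum>k=1..<a. g (real k)) =
      (\<Sum>k=1..<a. real n * (real k - t) ^ (n - 1) * (real a - real k) ^ n)"
    by (simp add: g_def n_def mult.assoc)
  ultimately show ?thesis by simp
qed

text \<open>Averaging the previous estimate over the shift \<open>t \<in> [0, 1]\<close>. The summand \<open>(k - t) ^ n\<close> of \<open>H\<close>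
turns the averaged Riemann sum into \<open>\<Sum>k. (k ^ n - (k - 1) ^ n) * (a - k) ^ n\<close>.\<close>

lemma separating_prob_estimate:
  fixes n a :: nat
  assumes n: "n \<ge> 3" and a: "a \<ge> 1"
  defines "\<alpha> \<equiv> 1 - 1 / real a"
  shows "\<bar>separating_prob n a - real a / (2 * real n + 1) * (1 - \<alpha> ^ (2 * n + 1))\<bar>
    \<le> 2 / (3 * real a) * (real n / (real n - 2)) * (1 - \<alpha> ^ (2 * n - 1))"
proof -
  define \<beta> where "\<beta> = ((fact n)\<^sup>2 / fact (2 * n) :: real)"
  define \<gamma> where "\<gamma> = (real n * real (n - 1) * fact (n - 3) * fact n / (3 * fact (2 * n - 2)) :: real)"
  define S where "S = (\<Sum>k=1..<a. (real k ^ n - (real k - 1) ^ n) * (real a - real k) ^ n)"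
  define C where "C = real ((2 * n) choose n)"
  define H where "H t = - (\<Sum>k=1..<a. (real k - t) ^ n * (real a - real k) ^ n)
     + \<beta> * (real a - t) ^ (2 * n + 1) / real (2 * n + 1)" for t
  define W where "W t = - \<gamma> * (real a - t) ^ (2 * n - 1) / real (2 * n - 1)" for t
  have "\<bar>H 1 - H 0\<bar> \<le> W 1 - W 0"
  proof (rule abs_increment_le)
    fix t :: real assume t: "t \<in> {0..1}"
    show "(H has_real_derivative (\<Sum>k=1..<a. real n * (real k - t) ^ (n - 1) * (real a - real k) ^ n)
        - \<beta> * (real a - t) ^ (2 * n)) (at t)"
      unfolding H_def
      by (rule derivative_eq_intros refl | simp)+
         (simp add: sum_negf[symmetric] field_simps)
    show "(W has_real_derivative \<gamma> * (real a - t) ^ (2 * n - 2)) (at t)"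
    proof -
      have j: "2 * n - 1 = Suc (2 * n - 2)" using n by simp
      have "((\<lambda>t. - \<gamma> * (real a - t) ^ Suc (2 * n - 2)) has_real_derivative
          real (Suc (2 * n - 2)) * (\<gamma> * (real a - t) ^ (2 * n - 2))) (at t)"
        by (rule derivative_eq_intros refl | simp)+
      from DERIV_cdivide[OF this, of "real (Suc (2 * n - 2))"] show ?thesis
        unfolding W_def j by (simp del: of_nat_Suc)
    qed
    have "n - 3 + 3 = n" using n by simp
    then show "\<bar>(\<Sum>k=1..<a. real n * (real k - t) ^ (n - 1) * (real a - real k) ^ n)
        - \<beta> * (real a - t) ^ (2 * n)\<bar> \<le> \<gamma> * (real a - t) ^ (2 * n - 2)"
      using riemann_sum_error[of t a "n - 3"] t a unfolding \<beta>_def \<gamma>_def by simp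
  qed simp
  moreover have "H 1 - H 0 = S - \<beta> * (real a ^ (2 * n + 1) - (real a - 1) ^ (2 * n + 1)) / (2 * real n + 1)"
    unfolding H_def S_def
    by (simp add: left_diff_distrib sum_subtractf diff_divide_distrib right_diff_distrib add.commute)
  moreover have "W 1 - W 0 = \<gamma> * (real a ^ (2 * n - 1) - (real a - 1) ^ (2 * n - 1)) / real (2 * n - 1)"
    unfolding W_def by (simp add: diff_divide_distrib right_diff_distrib)
  ultimately have "\<bar>S - \<beta> * (real a ^ (2 * n + 1) - (real a - 1) ^ (2 * n + 1)) / (2 * real n + 1)\<bar>
     \<le> \<gamma> * (real a ^ (2 * n - 1) - (real a - 1) ^ (2 * n - 1)) / real (2 * n - 1)" by simp
  moreover have pow: "(real a - 1) ^ j = real a ^ j * \<alpha> ^ j" for j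
    using a by (simp add: \<alpha>_def power_mult_distrib[symmetric] field_simps)
  ultimately have le: "\<bar>S - \<beta> * (real a ^ (2 * n + 1) * (1 - \<alpha> ^ (2 * n + 1))) / (2 * real n + 1)\<bar>
     \<le> \<gamma> * (real a ^ (2 * n - 1) * (1 - \<alpha> ^ (2 * n - 1))) / real (2 * n - 1)"
    by (simp only: pow right_diff_distrib mult_1_right)
  have C\<beta>: "C * \<beta> = 1"
    unfolding C_def \<beta>_def by (simp add: binomial_fact power2_eq_square)
  have C\<gamma>: "C * \<gamma> / real (2 * n - 1) = 2 * real n / (3 * (real n - 2))"
  proof -
    obtain m where m: "n = m + 3" using n by (metis add.commute le_Suc_ex)
    have f1: "(fact (2 * n) :: real) = real (2 * n) * real (2 * n - 1) * fact (2 * n - 2)"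
    proof -
      obtain j where "2 * n = Suc (Suc j)" using m by (intro that[of "2 * m + 4"]) simp
      then show ?thesis by simp
    qed
    have f2: "(fact n :: real) = real n * real (n - 1) * real (n - 2) * fact (n - 3)"
      unfolding m by (simp add: numeral_3_eq_3 algebra_simps)
    have C: "C = 2 * real n * real (2 * n - 1) * fact (2 * n - 2) /
        (fact n * (real n * real (n - 1) * real (n - 2) * fact (n - 3)))"
    proof -
      have "C = fact (2 * n) / (fact n * fact n)"
        unfolding C_def by (simp add: binomial_fact)
      then show ?thesis by (subst (asm) (2) f2) (simp only: f1 of_nat_mult of_nat_numeral)
    qed
    have "2 * N * r * q / (F * (N * n1 * n2 * p)) * (N * n1 * p * F / (3 * q)) / r = 2 * N / (3 * n2)"
      if "N \<noteq> 0" "r \<noteq> 0" "q \<noteq> 0" "F \<noteq> 0" "n1 \<noteq> 0" "n2 \<noteq> 0" "p \<noteq> 0" for N r q F n1 n2 p :: real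
      using that by (simp add: field_simps)
    from this[of "real n" "real (2 * n - 1)" "fact (2 * n - 2)" "fact n" "real (n - 1)" "real (n - 2)" "fact (n - 3)"]
    show ?thesis using n unfolding C \<gamma>_def by simp
  qed
  have a0: "real a > 0" using a by simp
  have sep: "separating_prob n a = C / real a ^ (2 * n) * S"
    by (simp add: separating_prob_def C_def S_def)
  have "\<bar>separating_prob n a - real a / (2 * real n + 1) * (1 - \<alpha> ^ (2 * n + 1))\<bar> =
     C / real a ^ (2 * n) * \<bar>S - \<beta> * (real a ^ (2 * n + 1) * (1 - \<alpha> ^ (2 * n + 1))) / (2 * real n + 1)\<bar>"
  proof -
    have "separating_prob n a - real a / (2 * real n + 1) * (1 - \<alpha> ^ (2 * n + 1)) =
      C / real a ^ (2 * n) * (S - \<beta> * (real a ^ (2 * n + 1) * (1 - \<alpha> ^ (2 * n + 1))) / (2 * real n + 1))"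
    proof -
      have "C / real a ^ (2 * n) * (\<beta> * (real a ^ (2 * n + 1) * (1 - \<alpha> ^ (2 * n + 1))) / (2 * real n + 1))
        = C * \<beta> * (real a / (2 * real n + 1) * (1 - \<alpha> ^ (2 * n + 1)))"
      proof -
        have "C / X * (\<beta> * (real a * X * Y) / D) = C * \<beta> * (real a / D * Y)"
          if "X \<noteq> 0" for X Y D :: real
          using that by simp
        moreover have "real a ^ (2 * n + 1) = real a * real a ^ (2 * n)" by simp
        ultimately show ?thesis using a0 by (simp only: power_eq_0_iff) simp
      qed
      then show ?thesis by (simp add: sep C\<beta> right_diff_distrib)
    qed
    then show ?thesis by (simp add: abs_mult C_def)
  qed
  also have "\<dots> \<le> C / real a ^ (2 * n) * (\<gamma> * (real a ^ (2 * n - 1) * (1 - \<alpha> ^ (2 * n - 1))) / real (2 * n - 1))"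
    by (intro mult_left_mono le) (simp add: C_def)
  also have "\<dots> = C * \<gamma> / real (2 * n - 1) * (real a ^ (2 * n - 1) / real a ^ (2 * n)) * (1 - \<alpha> ^ (2 * n - 1))"
    by (simp add: mult_ac)
  also have "real a ^ (2 * n - 1) / real a ^ (2 * n) = 1 / real a"
  proof -
    have "real a ^ (2 * n) = real a * real a ^ (2 * n - 1)"
      using n by (metis power_eq_if mult_eq_0_iff not_numeral_le_zero zero_neq_numeral)
    then show ?thesis using a0 by simp
  qed
  also have "C * \<gamma> / real (2 * n - 1) * (1 / real a) = 2 / (3 * real a) * (real n / (real n - 2))"
    unfolding C\<gamma> by simp
  finally show ?thesis .
qed

section \<open>Separation distance\<close>

text \<open>With \<open>j * A j = (\<Sum>i<j. \<alpha> ^ i)\<close>, the term added on passing from \<open>A m\<close> to \<open>A (m + 1)\<close> differs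
from the earlier ones by at most \<open>m / a\<close> and has weight \<open>1 / (m + 1)\<close>, so the average changes by at
most \<open>1 / a\<close>. The other \<open>1 / a\<close> pays for \<open>\<bar>\<alpha> - exp (- 1 / a)\<bar> \<le> 1 / a\<^sup>2\<close>: taking \<open>m\<close>-th powers
costs a factor \<open>m\<close>, and \<open>A m\<close> carries the factor \<open>a / m\<close>.\<close>

lemma geometric_average_exp_bound:
  fixes a m :: nat
  assumes a: "a \<ge> 1" and m: "m \<ge> 1"
  defines "\<alpha> \<equiv> 1 - 1 / real a" and "x \<equiv> real m / real a"
  shows "\<bar>real a / (real m + 1) * (1 - \<alpha> ^ (m + 1)) - (1 - exp (- x)) / x\<bar> \<le> 2 / real a"
proof -
  have a0: "real a > 0" and m0: "real m > 0" using a m by auto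
  have \<alpha>: "0 \<le> \<alpha>" "\<alpha> \<le> 1" "real a * (1 - \<alpha>) = 1" using a by (auto simp: \<alpha>_def)
  define A where "A j = real a / real j * (1 - \<alpha> ^ j)" for j :: nat
  have A_eq: "real j * A j = (\<Sum>i<j. \<alpha> ^ i)" if "j \<ge> 1" for j
  proof -
    have "real j * A j = real a * (1 - \<alpha> ^ j)" using that by (simp add: A_def)
    also have "\<dots> = real a * (1 - \<alpha>) * (\<Sum>i<j. \<alpha> ^ i)" by (simp add: one_diff_power_eq)
    finally show ?thesis using \<alpha> by simp
  qed
  have d1: "\<bar>A (m + 1) - A m\<bar> \<le> 1 / real a"
  proof -
    have "(real m + 1) * A (m + 1) = real m * A m + \<alpha> ^ m"
      using A_eq[of "m + 1"] A_eq[of m] m by (simp add: add.commute)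
    moreover have "(real m + 1) * real m * (A (m + 1) - A m) =
        real m * ((real m + 1) * A (m + 1)) - real m * ((real m + 1) * A m)"
      by (simp add: algebra_simps)
    ultimately have "(real m + 1) * real m * (A (m + 1) - A m) = real m * \<alpha> ^ m - real m * A m"
      by (simp add: algebra_simps)
    also have "\<dots> = (\<Sum>i<m. \<alpha> ^ m - \<alpha> ^ i)"
      using A_eq[OF m] by (simp add: sum_subtractf)
    also have "\<bar>\<dots>\<bar> \<le> (\<Sum>i<m. real m * (1 / real a))"
    proof (rule order_trans[OF sum_abs sum_mono])
      fix i assume i: "i \<in> {..<m}"
      have "\<alpha> ^ m = \<alpha> ^ i * \<alpha> ^ (m - i)" using i by (simp flip: power_add)
      then have "\<alpha> ^ i - \<alpha> ^ m = \<alpha> ^ i * (1 ^ (m - i) - \<alpha> ^ (m - i))"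
        by (simp add: algebra_simps)
      also have "\<bar>\<dots>\<bar> \<le> 1 * (real (m - i) * \<bar>1 - \<alpha>\<bar>)"
        unfolding abs_mult
        using norm_power_diff[of 1 \<alpha> "m - i"] \<alpha>
        by (intro mult_mono) (auto simp: power_le_one)
      also have "\<dots> \<le> real m * (1 / real a)"
        by (auto simp: \<alpha>_def intro!: divide_right_mono)
      finally show "\<bar>\<alpha> ^ m - \<alpha> ^ i\<bar> \<le> real m * (1 / real a)" by (simp add: abs_minus_commute)
    qed
    finally have "(real m + 1) * real m * \<bar>A (m + 1) - A m\<bar> \<le> real m * real m * (1 / real a)"
      by (simp add: abs_mult)
    also have "\<dots> \<le> (real m + 1) * real m * (1 / real a)"
      by (intro mult_right_mono) auto
    finally show ?thesis
      using m0 by (subst (asm) mult_le_cancel_left_pos) simp_all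
  qed
  have d2: "\<bar>A m - (1 - exp (- x)) / x\<bar> \<le> 1 / real a"
  proof -
    have e: "\<bar>exp (- (1 / real a)) - \<alpha>\<bar> \<le> 1 / real a ^ 2"
    proof -
      have "exp (- (1 / real a)) \<ge> \<alpha>" using exp_ge_add_one_self[of "- (1 / real a)"] by (simp add: \<alpha>_def)
      moreover have "exp (- (1 / real a)) \<le> 1 / (1 + 1 / real a)"
        using exp_ge_add_one_self[of "1 / real a"] a0
        by (auto simp: exp_minus inverse_eq_divide intro!: divide_left_mono mult_pos_pos add_pos_pos)
      moreover have "1 / (1 + 1 / real a) - \<alpha> \<le> 1 / real a ^ 2"
      proof -
        define y where "y = 1 / real a"
        have "y \<ge> 0" by (simp add: y_def)
        then have "1 \<le> (1 - y + y^2) * (1 + y)" by (simp add: algebra_simps power2_eq_square)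
        with \<open>y \<ge> 0\<close> have "1 / (1 + y) \<le> 1 - y + y^2" by (simp add: divide_le_eq)
        then show ?thesis by (simp add: \<alpha>_def y_def power_divide)
      qed
      ultimately show ?thesis by linarith
    qed
    have "A m - (1 - exp (- x)) / x = real a / real m * (exp (- (1 / real a)) ^ m - \<alpha> ^ m)"
      using a0 m0 by (simp add: A_def x_def exp_of_nat_mult[symmetric] field_simps)
    also have "\<bar>\<dots>\<bar> = real a / real m * \<bar>exp (- (1 / real a)) ^ m - \<alpha> ^ m\<bar>"
      by (simp add: abs_mult)
    also have "\<dots> \<le> real a / real m * (real m * (1 / real a ^ 2))"
    proof (intro mult_left_mono)
      have "\<bar>exp (- (1 / real a)) ^ m - \<alpha> ^ m\<bar> \<le> real m * \<bar>exp (- (1 / real a)) - \<alpha>\<bar>"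
        using norm_power_diff[of "exp (- (1 / real a))" \<alpha> m] \<alpha> by simp
      also have "\<dots> \<le> real m * (1 / real a ^ 2)"
        using e by (intro mult_left_mono) auto
      finally show "\<bar>exp (- (1 / real a)) ^ m - \<alpha> ^ m\<bar> \<le> real m * (1 / real a ^ 2)" .
    qed simp
    also have "\<dots> = 1 / real a" using a0 m0 by (simp add: power2_eq_square)
    finally show ?thesis .
  qed
  have "real a / (real m + 1) * (1 - \<alpha> ^ (m + 1)) = A (m + 1)"
    by (simp add: A_def add.commute)
  moreover have "\<bar>A (m + 1) - (1 - exp (- x)) / x\<bar> \<le> 1 / real a + 1 / real a"
    using abs_triangle_ineq[of "A (m + 1) - A m" "A m - (1 - exp (- x)) / x"] d1 d2 by simp
  ultimately show ?thesis by simp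
qed

lemma one_minus_inverse_power_pos:
  fixes a j :: nat
  assumes "a \<ge> 1" "j \<ge> 1"
  shows "1 - (1 - 1 / real a) ^ j > 0" "(1 - 1 / real a) ^ j \<ge> 0"
proof -
  have "0 \<le> 1 - 1 / real a" "1 - 1 / real a < 1" using assms by auto
  then have "(1 - 1 / real a) ^ j < 1 ^ j" using assms by (intro power_strict_mono) auto
  then show "1 - (1 - 1 / real a) ^ j > 0" by simp
  show "(1 - 1 / real a) ^ j \<ge> 0" using \<open>0 \<le> 1 - 1 / real a\<close> by simp
qed

lemma SEP_expansion:
  assumes n: "n \<ge> 3" and a: "a \<ge> 1"
  shows "let \<alpha> = 1 - 1 / real a in
        \<exists>\<theta> :: real. - 1 \<le> \<theta> \<and> \<theta> \<le> 1 \<and>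
          SEP n a = 1 - real a / (2 * real n + 1) * (1 - \<alpha> ^ (2 * n + 1))
            + 2 * \<theta> / (3 * real a) * (real n / (real n - 2)) * (1 - \<alpha> ^ (2 * n - 1))"
proof -
  define \<alpha> where "\<alpha> = 1 - 1 / real a"
  define M where "M = real a / (2 * real n + 1) * (1 - \<alpha> ^ (2 * n + 1))"
  define E where "E = 2 / (3 * real a) * (real n / (real n - 2)) * (1 - \<alpha> ^ (2 * n - 1))"
  have E: "E > 0"
    unfolding E_def \<alpha>_def
    using one_minus_inverse_power_pos[OF a, of "2 * n - 1"] n a
    by (intro mult_pos_pos divide_pos_pos) auto
  have "\<bar>separating_prob n a - M\<bar> \<le> E"
    unfolding M_def E_def \<alpha>_def by (rule separating_prob_estimate[OF n a])
  then have est: "\<bar>SEP n a - (1 - M)\<bar> \<le> E" using SEP_eq[of n a] n a by simp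
  define \<theta> where "\<theta> = (SEP n a - (1 - M)) / E"
  have "\<bar>\<theta>\<bar> \<le> 1" using est E by (simp add: \<theta>_def)
  moreover have "SEP n a = 1 - M + \<theta> * E" using E by (simp add: \<theta>_def)
  ultimately show ?thesis
    unfolding Let_def \<alpha>_def[symmetric]
    by (intro exI[of _ \<theta>]) (auto simp: M_def E_def abs_le_iff mult_ac)
qed

text \<open>The factor \<open>n / (n - 2)\<close> is at most 3, so the error term of the expansion is at most \<open>2 / a\<close>; the
exponential approximation costs another \<open>2 / a\<close>.\<close>

lemma SEP_limit_profile:
  fixes c :: real
  assumes n: "n \<ge> 3" and a: "a \<ge> 1" and c: "real a = 2 powr (log 2 (2 * real n) + c)"
  shows "\<bar>SEP n a - (1 - 2 powr c * (1 - exp (- (2 powr (- c)))))\<bar> \<le> 4 / real a"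
proof -
  define \<alpha> where "\<alpha> = 1 - 1 / real a"
  define x where "x = real (2 * n) / real a"
  have "real a = 2 * real n * 2 powr c" using c n by (simp add: powr_add)
  then have x: "2 powr c = 1 / x" "2 powr (- c) = x"
    using n by (simp_all add: x_def powr_minus field_simps)
  have "2 / (3 * real a) * (real n / (real n - 2)) * (1 - \<alpha> ^ (2 * n - 1)) \<le> 2 / (3 * real a) * 3 * 1"
    using n a one_minus_inverse_power_pos[OF a, of "2 * n - 1"]
    by (intro mult_mono) (auto simp: \<alpha>_def field_simps)
  then have "2 / (3 * real a) * (real n / (real n - 2)) * (1 - \<alpha> ^ (2 * n - 1)) \<le> 2 / real a" by simp
  with separating_prob_estimate[OF n a]
  have e1: "\<bar>separating_prob n a - real a / (2 * real n + 1) * (1 - \<alpha> ^ (2 * n + 1))\<bar> \<le> 2 / real a"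
    unfolding \<alpha>_def by linarith
  have e2: "\<bar>real a / (2 * real n + 1) * (1 - \<alpha> ^ (2 * n + 1)) - (1 - exp (- x)) / x\<bar> \<le> 2 / real a"
    using geometric_average_exp_bound[OF a, of "2 * n"] n by (simp add: \<alpha>_def x_def)
  have "\<bar>p - r\<bar> \<le> d + d" if "\<bar>p - q\<bar> \<le> d" "\<bar>q - r\<bar> \<le> d" for p q r d :: real
    using that by linarith
  from this[OF e1 e2] have "\<bar>separating_prob n a - (1 - exp (- x)) / x\<bar> \<le> 2 / real a + 2 / real a" .
  moreover have "SEP n a = 1 - separating_prob n a" using SEP_eq[of n a] n a by simp
  ultimately have "\<bar>SEP n a - (1 - (1 - exp (- x)) / x)\<bar> \<le> 2 / real a + 2 / real a"
    by (simp add: abs_minus_commute)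
  then show ?thesis unfolding x by (simp add: add_divide_distrib[symmetric])
qed

theorem corollary4p4:
  shows "(\<forall>n a :: nat. n \<ge> 3 \<longrightarrow> a \<ge> 1 \<longrightarrow>
      (let \<alpha> = 1 - 1 / real a in
        \<exists>\<theta> :: real. - 1 \<le> \<theta> \<and> \<theta> \<le> 1 \<and>
          SEP n a = 1 - real a / (2 * real n + 1) * (1 - \<alpha> ^ (2 * n + 1))
            + 2 * \<theta> / (3 * real a) * (real n / (real n - 2)) * (1 - \<alpha> ^ (2 * n - 1))))
    \<and> (\<exists>(C :: real) (n0 :: nat). \<forall>(n :: nat) (a :: nat) (c :: real).
        n \<ge> n0 \<longrightarrow> a \<ge> 1 \<longrightarrow> real a = 2 powr (log 2 (2 * real n) + c) \<longrightarrow>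
          \<bar>SEP n a - (1 - 2 powr c * (1 - exp (- (2 powr (- c)))))\<bar> \<le> C / real a)"
  using SEP_expansion SEP_limit_profile by blast

end
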